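(* Let $X$ be a skeletal generalized metric space. Then $X$ is finitely complete if and only if it can be given the structure of a metric semi-tropical module. Similarly, $X$ is finitely cocomplete if and only if it can be given the structure of a co-metric semi-tropical module.
   Context: A generalized metric space is a set $X$ with a function $d\colon X\times X\to[0,\infty]$ such that $d(x,x)=0$ and $d(x,y)+d(y,z)\ge d(x,z)$ for all $x,y,z\in X$ (no symmetry, separation or finiteness is required). It is skeletal if $d(x,x')=0=d(x',x)$ implies $x=x'$. For $a,b\in[0,\infty]$ write $b\dot{-}a:=\max(b-a,0)$ (with $\infty\dot{-}\infty=0$); $[0,\infty]$ is a generalized metric space with $d(a,b)=b\dot{-}a$. The opposite $X^{\mathrm{op}}$ has the same points and reversed metric. A short map $F\colon X\to Y$ is a function with $d_X(x,x')\ge d_Y(F(x),F(x'))$. Let $D$ be a generalized metric space (a shape) and $J\colon D\to X$ a short map (a diagram). Given a short map $W\colon D^{\mathrm{op}}\to[0,\infty]$, a colimit of $J$ weighted by $W$ is a point $c\in X$ with $d(c,x)=\sup_{e\in D}(d(J(e),x)\dot{-}W(e))$ for all $x\in X$. Given a short map $W\colon D\to[0,\infty]$, a limit of $J$ weighted by $W$ is a point $l\in X$ with $d(x,l)=\sup_{e\in D}(d(x,J(e))\dot{-}W(e))$ for all $x\in X$. Suprema of empty families are $0$. $X$ is finitely cocomplete (resp. finitely complete) if all weighted colimits (resp. weighted limits) over all shapes $D$ with finitely many points exist. The semi-tropical semiring is $([0,\infty],\min,+)$: addition is $\min$ (with unit $\infty$), multiplication is $+$ (with unit $0$). A semi-tropical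 module is a commutative monoid $(M,\oplus,\mathbf 0)$ with an action $\odot\colon[0,\infty]\times M\to M$ such that $r\mapsto r\odot(-)$ is a unital semiring morphism from $([0,\infty],\min,+)$ to the semiring $(\operatorname{End}(M),\oplus,\circ)$ of monoid endomorphisms of $M$ (preserving addition, multiplication and both units). A morphism of semi-tropical modules is a monoid map preserving the action. The monoid $([0,\infty],\max)$ (unit $0$) is a semi-tropical module via $r\odot m:=m\dot{-}r$. A co-metric semi-tropical module structure on $X$ is a semi-tropical module structure on the set $X$ such that for every $x\in X$ the map $d(-,x)\colon X\to([0,\infty],\max)$ is a morphism of semi-tropical modules. A metric semi-tropical module structure on $X$ is a semi-tropical module structure on the set $X$ such that for every $x\in X$ the map $d(x,-)\colon X\to([0,\infty],\max)$ is a morphism of semi-tropical modules. *)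

theory Defs
  imports "HOL-Analysis.Analysis" "HOL-Algebra.Ring"
begin

section \<open>Generalized metric spaces\<close>

text \<open>
  The subtraction of \<^typ>\<open>ennreal\<close> has \<open>\<infinity> - \<infinity> = \<infinity>\<close>, whereas here the truncated difference
  of \<open>\<infinity>\<close> and \<open>\<infinity>\<close> is \<open>0\<close>; the two agree on all other arguments.
\<close>

definition monus :: "ennreal \<Rightarrow> ennreal \<Rightarrow> ennreal"  (infixl \<open>\<midarrow>\<close> 65)
  where "b \<midarrow> a = (if b \<le> a then 0 else b - a)"

locale gen_metric_space =
  fixes X :: "'a set" and d :: "'a \<Rightarrow> 'a \<Rightarrow> ennreal"
  assumes dist_self: "x \<in> X \<Longrightarrow> d x x = 0"
    and dist_triangle: "\<lbrakk>x \<in> X; y \<in> X; z \<in> X\<rbrakk> \<Longrightarrow> d x y + d y z \<ge> d x z"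

locale skeletal_gen_metric_space = gen_metric_space +
  assumes skeletal: "\<lbrakk>x \<in> X; x' \<in> X; d x x' = 0; d x' x = 0\<rbrakk> \<Longrightarrow> x = x'"

definition ennreal_gdist :: "ennreal \<Rightarrow> ennreal \<Rightarrow> ennreal"
  where "ennreal_gdist a b = b \<midarrow> a"

definition op_dist :: "('a \<Rightarrow> 'a \<Rightarrow> ennreal) \<Rightarrow> 'a \<Rightarrow> 'a \<Rightarrow> ennreal"
  where "op_dist d x y = d y x"

definition short_map ::
  "'a set \<Rightarrow> ('a \<Rightarrow> 'a \<Rightarrow> ennreal) \<Rightarrow> 'b set \<Rightarrow> ('b \<Rightarrow> 'b \<Rightarrow> ennreal) \<Rightarrow> ('a \<Rightarrow> 'b) \<Rightarrow> bool"
  where "short_map X dX Y dY F \<longleftrightarrow>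
    F ` X \<subseteq> Y \<and> (\<forall>x\<in>X. \<forall>x'\<in>X. dX x x' \<ge> dY (F x) (F x'))"


section \<open>Weighted limits and colimits\<close>

text \<open>
  The supremum of the empty family in \<^typ>\<open>ennreal\<close> is \<open>0\<close>.
\<close>

definition is_weighted_colimit ::
  "'a set \<Rightarrow> ('a \<Rightarrow> 'a \<Rightarrow> ennreal) \<Rightarrow> 'i set \<Rightarrow> ('i \<Rightarrow> 'a) \<Rightarrow> ('i \<Rightarrow> ennreal) \<Rightarrow> 'a \<Rightarrow> bool"
  where "is_weighted_colimit X d D J W c \<longleftrightarrow>
    c \<in> X \<and> (\<forall>x\<in>X. d c x = (SUP e\<in>D. d (J e) x \<midarrow> W e))"

definition is_weighted_limit ::
  "'a set \<Rightarrow> ('a \<Rightarrow> 'a \<Rightarrow> ennreal) \<Rightarrow> 'i set \<Rightarrow> ('i \<Rightarrow> 'a) \<Rightarrow> ('i \<Rightarrow> ennreal) \<Rightarrow> 'a \<Rightarrow> bool"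
  where "is_weighted_limit X d D J W l \<longleftrightarrow>
    l \<in> X \<and> (\<forall>x\<in>X. d x l = (SUP e\<in>D. d x (J e) \<midarrow> W e))"

text \<open>
  Since one cannot quantify over types inside a formula, the finite shapes are taken with points in
  \<^typ>\<open>nat\<close>. Every finite space is isometric to one of these, and the lemmas
  \<open>finitely_cocomplete_shape\<close> and \<open>finitely_complete_shape\<close> below extend the property to
  finite shapes over an arbitrary type.
\<close>

definition finitely_cocomplete :: "'a set \<Rightarrow> ('a \<Rightarrow> 'a \<Rightarrow> ennreal) \<Rightarrow> bool"
  where "finitely_cocomplete X d \<longleftrightarrow>
    (\<forall>(D :: nat set) dD J W.
      finite D \<longrightarrow> gen_metric_space D dD \<longrightarrow> short_map D dD X d J \<longrightarrow>
      short_map D (op_dist dD) UNIV ennreal_gdist W \<longrightarrow>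
      (\<exists>c. is_weighted_colimit X d D J W c))"

definition finitely_complete :: "'a set \<Rightarrow> ('a \<Rightarrow> 'a \<Rightarrow> ennreal) \<Rightarrow> bool"
  where "finitely_complete X d \<longleftrightarrow>
    (\<forall>(D :: nat set) dD J W.
      finite D \<longrightarrow> gen_metric_space D dD \<longrightarrow> short_map D dD X d J \<longrightarrow>
      short_map D dD UNIV ennreal_gdist W \<longrightarrow>
      (\<exists>l. is_weighted_limit X d D J W l))"

lemma finite_shape_transport:
  fixes D :: "'i set"
  assumes "finite D"
  obtains D' :: "nat set" and f :: "nat \<Rightarrow> 'i" where "finite D'" "f ` D' = D"
proof -
  obtain f :: "nat \<Rightarrow> 'i" where "bij_betw f {0..<card D} D"
    using assms ex_bij_betw_nat_finite by blast
  then show ?thesis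
    using that[of "{0..<card D}" f] by (auto simp: bij_betw_def)
qed

lemma finitely_cocomplete_shape:
  fixes D :: "'i set"
  assumes X: "finitely_cocomplete X d"
    and D: "finite D" "gen_metric_space D dD" "short_map D dD X d J"
      "short_map D (op_dist dD) UNIV ennreal_gdist W"
  shows "\<exists>c. is_weighted_colimit X d D J W c"
proof -
  obtain D' :: "nat set" and f where f: "finite D'" "f ` D' = D"
    using finite_shape_transport[OF D(1)] .
  have fD: "f e \<in> D" if "e \<in> D'" for e using f(2) that by blast
  let ?dD = "\<lambda>i j. dD (f i) (f j)"
  have "gen_metric_space D' ?dD"
    using D(2) fD by (simp add: gen_metric_space_def)
  moreover have "short_map D' ?dD X d (J \<circ> f)"
    using D(3) fD by (auto simp: short_map_def)
  moreover have "short_map D' (op_dist ?dD) UNIV ennreal_gdist (W \<circ> f)"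
    using D(4) fD by (auto simp: short_map_def op_dist_def)
  ultimately obtain c where "is_weighted_colimit X d D' (J \<circ> f) (W \<circ> f) c"
    using X f(1) unfolding finitely_cocomplete_def by blast
  then have "is_weighted_colimit X d D J W c"
    unfolding is_weighted_colimit_def f(2)[symmetric] by (simp add: image_image)
  then show ?thesis ..
qed

lemma finitely_complete_shape:
  fixes D :: "'i set"
  assumes X: "finitely_complete X d"
    and D: "finite D" "gen_metric_space D dD" "short_map D dD X d J"
      "short_map D dD UNIV ennreal_gdist W"
  shows "\<exists>l. is_weighted_limit X d D J W l"
proof -
  obtain D' :: "nat set" and f where f: "finite D'" "f ` D' = D"
    using finite_shape_transport[OF D(1)] .
  have fD: "f e \<in> D" if "e \<in> D'" for e using f(2) that by blast
  let ?dD = "\<lambda>i j. dD (f i) (f j)"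
  have "gen_metric_space D' ?dD"
    using D(2) fD by (simp add: gen_metric_space_def)
  moreover have "short_map D' ?dD X d (J \<circ> f)"
    using D(3) fD by (auto simp: short_map_def)
  moreover have "short_map D' ?dD UNIV ennreal_gdist (W \<circ> f)"
    using D(4) fD by (auto simp: short_map_def)
  ultimately obtain l where "is_weighted_limit X d D' (J \<circ> f) (W \<circ> f) l"
    using X f(1) unfolding finitely_complete_def by blast
  then have "is_weighted_limit X d D J W l"
    unfolding is_weighted_limit_def f(2)[symmetric] by (simp add: image_image)
  then show ?thesis ..
qed


section \<open>Semi-tropical modules\<close>

text \<open>
  The record type \<open>ring\<close> only supplies the signature of a semiring; no additive inverses are assumed.
  A commutative monoid \<open>(M, \<oplus>, \<zero>)\<close> is a multiplicatively written \<open>comm_monoid\<close>, so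
  \<open>\<otimes>\<^bsub>M\<^esub>\<close> and \<open>\<one>\<^bsub>M\<^esub>\<close> are its addition and its zero.
\<close>

definition semi_tropical_semiring :: "ennreal ring"
  where "semi_tropical_semiring =
    \<lparr>carrier = UNIV, mult = (+), one = 0, zero = \<infinity>, add = min\<rparr>"

definition monoid_homs :: "('a, 'm) monoid_scheme \<Rightarrow> ('b, 'n) monoid_scheme \<Rightarrow> ('a \<Rightarrow> 'b) set"
  where "monoid_homs M N = {h \<in> hom M N. h \<one>\<^bsub>M\<^esub> = \<one>\<^bsub>N\<^esub>}"

text \<open>
  Endomorphisms are represented by extensional functions (equal to \<^const>\<open>undefined\<close> off the
  carrier), so that equality in the semiring is equality of maps on the carrier.
\<close>

definition End_semiring :: "('a, 'm) monoid_scheme \<Rightarrow> ('a \<Rightarrow> 'a) ring"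
  where "End_semiring M =
    \<lparr>carrier = monoid_homs M M \<inter> extensional (carrier M),
     mult = compose (carrier M),
     one = (\<lambda>x\<in>carrier M. x),
     zero = (\<lambda>x\<in>carrier M. \<one>\<^bsub>M\<^esub>),
     add = (\<lambda>f g. \<lambda>x\<in>carrier M. f x \<otimes>\<^bsub>M\<^esub> g x)\<rparr>"

text \<open>
  \<^const>\<open>ring_hom\<close> preserves addition, multiplication and \<open>\<one>\<close>; preservation of \<open>\<zero>\<close> has to be added.
\<close>

definition semiring_homs :: "('a, 'm) ring_scheme \<Rightarrow> ('b, 'n) ring_scheme \<Rightarrow> ('a \<Rightarrow> 'b) set"
  where "semiring_homs R S = {h \<in> ring_hom R S. h \<zero>\<^bsub>R\<^esub> = \<zero>\<^bsub>S\<^esub>}"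

definition semi_tropical_module :: "('a, 'm) monoid_scheme \<Rightarrow> (ennreal \<Rightarrow> 'a \<Rightarrow> 'a) \<Rightarrow> bool"
  where "semi_tropical_module M act \<longleftrightarrow>
    comm_monoid M \<and>
    (\<lambda>r. \<lambda>m\<in>carrier M. act r m) \<in> semiring_homs semi_tropical_semiring (End_semiring M)"

definition module_morphism ::
  "('a, 'm) monoid_scheme \<Rightarrow> (ennreal \<Rightarrow> 'a \<Rightarrow> 'a) \<Rightarrow>
   ('b, 'n) monoid_scheme \<Rightarrow> (ennreal \<Rightarrow> 'b \<Rightarrow> 'b) \<Rightarrow> ('a \<Rightarrow> 'b) \<Rightarrow> bool"
  where "module_morphism M act N act' h \<longleftrightarrow>
    h \<in> monoid_homs M N \<and> (\<forall>r. \<forall>m\<in>carrier M. h (act r m) = act' r (h m))"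

definition max_monoid :: "ennreal monoid"
  where "max_monoid = \<lparr>carrier = UNIV, mult = max, one = 0\<rparr>"

definition max_act :: "ennreal \<Rightarrow> ennreal \<Rightarrow> ennreal"
  where "max_act r m = m \<midarrow> r"

definition metric_semi_tropical_module ::
  "'a set \<Rightarrow> ('a \<Rightarrow> 'a \<Rightarrow> ennreal) \<Rightarrow> 'a monoid \<Rightarrow> (ennreal \<Rightarrow> 'a \<Rightarrow> 'a) \<Rightarrow> bool"
  where "metric_semi_tropical_module X d M act \<longleftrightarrow>
    carrier M = X \<and> semi_tropical_module M act \<and>
    (\<forall>x\<in>X. module_morphism M act max_monoid max_act (\<lambda>y. d x y))"

definition cometric_semi_tropical_module ::
  "'a set \<Rightarrow> ('a \<Rightarrow> 'a \<Rightarrow> ennreal) \<Rightarrow> 'a monoid \<Rightarrow> (ennreal \<Rightarrow> 'a \<Rightarrow> 'a) \<Rightarrow> bool"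
  where "cometric_semi_tropical_module X d M act \<longleftrightarrow>
    carrier M = X \<and> semi_tropical_module M act \<and>
    (\<forall>x\<in>X. module_morphism M act max_monoid max_act (\<lambda>y. d y x))"

lemma semi_tropical_module_iff:
  "semi_tropical_module M act \<longleftrightarrow>
    comm_monoid M \<and>
    (\<forall>r. \<forall>m\<in>carrier M. act r m \<in> carrier M) \<and>
    (\<forall>r. \<forall>m\<in>carrier M. \<forall>n\<in>carrier M. act r (m \<otimes>\<^bsub>M\<^esub> n) = act r m \<otimes>\<^bsub>M\<^esub> act r n) \<and>
    (\<forall>r. act r \<one>\<^bsub>M\<^esub> = \<one>\<^bsub>M\<^esub>) \<and>
    (\<forall>r s. \<forall>m\<in>carrier M. act (r + s) m = act r (act s m)) \<and>
    (\<forall>r s. \<forall>m\<in>carrier M. act (min r s) m = act r m \<otimes>\<^bsub>M\<^esub> act s m) \<and>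
    (\<forall>m\<in>carrier M. act 0 m = m) \<and>
    (\<forall>m\<in>carrier M. act \<infinity> m = \<one>\<^bsub>M\<^esub>)"
proof (cases "comm_monoid M")
  case True
  then interpret comm_monoid M .
  have ext: "(restrict f (carrier M) = restrict g (carrier M)) \<longleftrightarrow> (\<forall>m\<in>carrier M. f m = g m)"
    for f g :: "'a \<Rightarrow> 'a"
    by (metis restrict_apply' restrict_ext)
  have carr: "(restrict (act r) (carrier M) \<in> carrier (End_semiring M)) \<longleftrightarrow>
      (\<forall>m\<in>carrier M. act r m \<in> carrier M) \<and>
      (\<forall>m\<in>carrier M. \<forall>n\<in>carrier M. act r (m \<otimes>\<^bsub>M\<^esub> n) = act r m \<otimes>\<^bsub>M\<^esub> act r n) \<and>
      act r \<one>\<^bsub>M\<^esub> = \<one>\<^bsub>M\<^esub>" for r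
    by (auto simp: End_semiring_def monoid_homs_def hom_def Pi_iff)
  have A: "(\<forall>r. restrict (act r) (carrier M) \<in> carrier (End_semiring M)) \<longleftrightarrow>
      (\<forall>r. \<forall>m\<in>carrier M. act r m \<in> carrier M) \<and>
      (\<forall>r. \<forall>m\<in>carrier M. \<forall>n\<in>carrier M. act r (m \<otimes>\<^bsub>M\<^esub> n) = act r m \<otimes>\<^bsub>M\<^esub> act r n) \<and>
      (\<forall>r. act r \<one>\<^bsub>M\<^esub> = \<one>\<^bsub>M\<^esub>)"
    unfolding carr by blast
  have mul: "restrict (act r) (carrier M) \<otimes>\<^bsub>End_semiring M\<^esub> restrict (act s) (carrier M) =
      (\<lambda>m\<in>carrier M. act r (act s m))" if "\<forall>r. \<forall>m\<in>carrier M. act r m \<in> carrier M" for r s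
    using that by (auto simp: End_semiring_def compose_def)
  have add: "restrict (act r) (carrier M) \<oplus>\<^bsub>End_semiring M\<^esub> restrict (act s) (carrier M) =
      (\<lambda>m\<in>carrier M. act r m \<otimes>\<^bsub>M\<^esub> act s m)" for r s
    by (auto simp: End_semiring_def)
  have "semi_tropical_module M act \<longleftrightarrow>
      (\<forall>r. restrict (act r) (carrier M) \<in> carrier (End_semiring M)) \<and>
      (\<forall>r s. restrict (act (r + s)) (carrier M) =
        restrict (act r) (carrier M) \<otimes>\<^bsub>End_semiring M\<^esub> restrict (act s) (carrier M)) \<and>
      (\<forall>r s. restrict (act (min r s)) (carrier M) =
        restrict (act r) (carrier M) \<oplus>\<^bsub>End_semiring M\<^esub> restrict (act s) (carrier M)) \<and>
      restrict (act 0) (carrier M) = (\<lambda>m\<in>carrier M. m) \<and>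
      restrict (act \<infinity>) (carrier M) = (\<lambda>m\<in>carrier M. \<one>\<^bsub>M\<^esub>)"
    using True
    by (auto simp: semi_tropical_module_def semiring_homs_def ring_hom_def
        semi_tropical_semiring_def End_semiring_def)
  also have "\<dots> \<longleftrightarrow> (\<forall>r. restrict (act r) (carrier M) \<in> carrier (End_semiring M)) \<and>
      (\<forall>r s. \<forall>m\<in>carrier M. act (r + s) m = act r (act s m)) \<and>
      (\<forall>r s. \<forall>m\<in>carrier M. act (min r s) m = act r m \<otimes>\<^bsub>M\<^esub> act s m) \<and>
      (\<forall>m\<in>carrier M. act 0 m = m) \<and>
      (\<forall>m\<in>carrier M. act \<infinity> m = \<one>\<^bsub>M\<^esub>)"
    by (rule conj_cong[OF refl]) (simp add: A mul add ext)
  finally show ?thesis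
    using True unfolding A by blast
qed (simp add: semi_tropical_module_def)

lemma semiring_semi_tropical: "semiring semi_tropical_semiring"
proof -
  have "z + min x y = min (x + z) (y + z)" for x y z :: ennreal
    by (auto simp: min_def add.commute[of z] intro!: antisym add_right_mono)
  then show ?thesis
    by unfold_locales
      (auto simp: semi_tropical_semiring_def Units_def min.assoc min.commute min.left_commute add_ac top_unique)
qed

lemma semiring_End:
  assumes "comm_monoid M"
  shows "semiring (End_semiring M)"
proof -
  interpret comm_monoid M by fact
  show ?thesis
    by unfold_locales
      (auto simp: End_semiring_def monoid_homs_def hom_def Pi_iff compose_def m_ac
        extensional_def restrict_def fun_eq_iff)
qed

lemma monus_le_iff: "b \<midarrow> a \<le> t \<longleftrightarrow> b \<le> a + t"
proof (cases "b \<le> a")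
  case True
  then show ?thesis by (simp add: monus_def add_increasing2)
next
  case False
  then have "a \<noteq> \<infinity>" by (auto simp: top_unique)
  with False show ?thesis by (simp add: monus_def ennreal_minus_le_iff)
qed

lemma gen_metric_space_ennreal: "gen_metric_space UNIV ennreal_gdist"
proof
  fix a b c :: ennreal
  show "ennreal_gdist a a = 0"
    by (simp add: ennreal_gdist_def monus_def)
  have "c \<le> b + (c \<midarrow> b)" "b \<le> a + (b \<midarrow> a)"
    by (simp_all flip: monus_le_iff)
  then have "c \<le> a + ((b \<midarrow> a) + (c \<midarrow> b))"
    by (metis add.assoc add_right_mono order_trans)
  then show "ennreal_gdist a c \<le> ennreal_gdist a b + ennreal_gdist b c"
    by (simp add: ennreal_gdist_def monus_le_iff)
qed

lemma semi_tropical_module_max: "semi_tropical_module max_monoid max_act"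
proof -
  have eqI: "a = b" if "\<And>t. a \<le> t \<longleftrightarrow> b \<le> t" for a b :: ennreal
    using that by (meson order_antisym order_refl)
  have 1: "max m n \<midarrow> r = max (m \<midarrow> r) (n \<midarrow> r)" for m n r
    by (rule eqI) (simp add: monus_le_iff)
  have 2: "m \<midarrow> (r + s) = (m \<midarrow> s) \<midarrow> r" for m r s
    by (rule eqI) (simp add: monus_le_iff add_ac)
  have 3: "m \<midarrow> min r s = max (m \<midarrow> r) (m \<midarrow> s)" for m r s
    by (rule eqI) (metis (no_types, lifting) add_right_mono linear max.bounded_iff min_def monus_le_iff order_trans)
  have "comm_monoid max_monoid"
    by unfold_locales (auto simp: max_monoid_def Units_def max.assoc max.commute max.left_commute)
  then show ?thesis
    unfolding semi_tropical_module_iff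
    by (simp add: max_monoid_def max_act_def 1 2 3) (simp add: monus_def)
qed

end

theory Submission
  imports Defs
begin

text \<open>
  By skeletality a point \<open>c\<close> is determined by the function \<open>d(-, c)\<close> that it represents. Weighted limits
  are described by these functions: the terminal point, the limit of \<open>m\<close> and \<open>n\<close> with weights \<open>0\<close>,
  and the limit of \<open>m\<close> alone with weight \<open>r\<close> represent \<open>0\<close>, \<open>max (d(-, m)) (d(-, n))\<close> and
  \<open>d(-, m) \<midarrow> r\<close>. These are exactly the values that the three operations of a metric module must
  have. So if the limits exist, they define the operations, and every module law holds because
  it holds pointwise in the module \<open>([0,\<infinity>], max)\<close>, into which the maps \<open>d(x, -)\<close> are jointly
  injective (\<open>module_of_jointly_injective\<close>).

  Conversely, in a metric module the finite sum of the points \<open>W e \<odot> J e\<close> is the limit of \<open>J\<close>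
  weighted by \<open>W\<close>: finite suprema in \<open>[0,\<infinity>]\<close> are iterated maxima starting from \<open>0\<close>.

  Colimits and co-metric modules are limits and metric modules for the reversed metric.
\<close>

text \<open>
  At distance \<open>\<infinity>\<close> between distinct points, every diagram and every weight is short, so finite
  completeness yields a limit for arbitrary functions on a finite set.
\<close>

lemma finitely_complete_discrete:
  fixes D :: "'i set"
  assumes "gen_metric_space X d" "finitely_complete X d" "finite D" "J ` D \<subseteq> X"
  shows "\<exists>l. is_weighted_limit X d D J W l"
proof -
  interpret gen_metric_space X d by fact
  define dD :: "'i \<Rightarrow> 'i \<Rightarrow> ennreal" where "dD i j = (if i = j then 0 else \<infinity>)" for i j
  have "gen_metric_space D dD"
    by unfold_locales (auto simp: dD_def)
  moreover have "short_map D dD X d J"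
    using assms(4) by (auto simp: short_map_def dD_def intro!: dist_self)
  moreover have "short_map D dD UNIV ennreal_gdist W"
    by (auto simp: short_map_def dD_def ennreal_gdist_def monus_def)
  ultimately show ?thesis
    by (rule finitely_complete_shape[OF assms(2,3)])
qed

text \<open>
  Equational laws pass from a module to any structure with a jointly injective family of maps into
  that module which preserve the operations.
\<close>

lemma module_of_jointly_injective:
  assumes N: "semi_tropical_module N act'"
    and closed: "\<one>\<^bsub>M\<^esub> \<in> carrier M"
      "\<And>m n. m \<in> carrier M \<Longrightarrow> n \<in> carrier M \<Longrightarrow> m \<otimes>\<^bsub>M\<^esub> n \<in> carrier M"
      "\<And>r m. m \<in> carrier M \<Longrightarrow> act r m \<in> carrier M"
    and maps: "\<And>i m. i \<in> I \<Longrightarrow> m \<in> carrier M \<Longrightarrow> h i m \<in> carrier N"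
      "\<And>i. i \<in> I \<Longrightarrow> h i \<one>\<^bsub>M\<^esub> = \<one>\<^bsub>N\<^esub>"
      "\<And>i m n. i \<in> I \<Longrightarrow> m \<in> carrier M \<Longrightarrow> n \<in> carrier M \<Longrightarrow>
         h i (m \<otimes>\<^bsub>M\<^esub> n) = h i m \<otimes>\<^bsub>N\<^esub> h i n"
      "\<And>i r m. i \<in> I \<Longrightarrow> m \<in> carrier M \<Longrightarrow> h i (act r m) = act' r (h i m)"
    and inj: "\<And>m n. m \<in> carrier M \<Longrightarrow> n \<in> carrier M \<Longrightarrow> (\<And>i. i \<in> I \<Longrightarrow> h i m = h i n) \<Longrightarrow> m = n"
  shows "semi_tropical_module M act"
proof -
  note laws = N[unfolded semi_tropical_module_iff]
  interpret N: comm_monoid N using laws by blast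
  have M: "comm_monoid M"
    by (rule comm_monoidI; (rule inj)?) (simp_all add: closed maps N.m_assoc N.m_comm N.m_lcomm)
  show ?thesis
    unfolding semi_tropical_module_iff
    by (intro conjI allI ballI; (rule inj)?)
      (simp_all add: M closed maps laws del: infinity_ennreal_def)
qed

lemma metric_module_of_finitely_complete:
  assumes X: "skeletal_gen_metric_space X d" and complete: "finitely_complete X d"
  shows "\<exists>M act. metric_semi_tropical_module X d M act"
proof -
  interpret skeletal_gen_metric_space X d by fact
  note lim = finitely_complete_discrete[OF gen_metric_space_axioms complete]
  have "\<exists>t. t \<in> X \<and> (\<forall>x\<in>X. d x t = 0)"
    using lim[of "{} :: nat set"] by (auto simp: is_weighted_limit_def bot_ennreal)
  then obtain t where t: "t \<in> X" "\<And>x. x \<in> X \<Longrightarrow> d x t = 0"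
    by blast
  have zero: "b \<midarrow> 0 = b" for b
    by (simp add: monus_def)
  have "\<exists>l. l \<in> X \<and> (\<forall>x\<in>X. d x l = max (d x m) (d x n))" if "m \<in> X" "n \<in> X" for m n
    using lim[of "{m, n}" "\<lambda>e. e" "\<lambda>_. 0"] that by (simp add: is_weighted_limit_def zero sup_max)
  then obtain p where p: "\<And>m n. m \<in> X \<Longrightarrow> n \<in> X \<Longrightarrow> p m n \<in> X"
    "\<And>m n x. m \<in> X \<Longrightarrow> n \<in> X \<Longrightarrow> x \<in> X \<Longrightarrow> d x (p m n) = max (d x m) (d x n)"
    by metis
  define a where "a r m = (SOME l. l \<in> X \<and> (\<forall>x\<in>X. d x l = d x m \<midarrow> r))" for r m
  have "\<exists>l. l \<in> X \<and> (\<forall>x\<in>X. d x l = d x m \<midarrow> r)" if "m \<in> X" for r m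
    using lim[of "{m}" "\<lambda>e. e" "\<lambda>_. r"] that by (auto simp: is_weighted_limit_def)
  then have "a r m \<in> X \<and> (\<forall>x\<in>X. d x (a r m) = d x m \<midarrow> r)" if "m \<in> X" for r m
    unfolding a_def by (rule someI_ex) (fact that)
  then have a: "\<And>r m. m \<in> X \<Longrightarrow> a r m \<in> X"
    "\<And>r m x. m \<in> X \<Longrightarrow> x \<in> X \<Longrightarrow> d x (a r m) = d x m \<midarrow> r"
    by simp_all
  define M where "M = \<lparr>carrier = X, mult = p, one = t\<rparr>"
  have "semi_tropical_module M a"
  proof (rule module_of_jointly_injective[OF semi_tropical_module_max, where I = X and h = d])
    fix m n assume mn: "m \<in> carrier M" "n \<in> carrier M" and eq: "\<And>x. x \<in> X \<Longrightarrow> d x m = d x n"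
    then show "m = n"
      using eq[of m] eq[of n] by (auto simp: M_def dist_self intro: skeletal)
  qed (simp_all add: M_def max_monoid_def max_act_def t p a)
  then have "metric_semi_tropical_module X d M a"
    by (auto simp: metric_semi_tropical_module_def module_morphism_def monoid_homs_def hom_def
        M_def max_monoid_def max_act_def t p a)
  then show ?thesis by blast
qed

lemma metric_module_weighted_limit:
  assumes M: "metric_semi_tropical_module X d M act" and "finite D" "J ` D \<subseteq> X"
  shows "\<exists>l. is_weighted_limit X d D J W l"
proof -
  interpret comm_monoid M
    using M by (simp add: metric_semi_tropical_module_def semi_tropical_module_def)
  have car: "carrier M = X"
    using M by (simp add: metric_semi_tropical_module_def)
  show ?thesis
    using assms(2,3)
  proof (induction D)
    case empty
    have "is_weighted_limit X d {} J W \<one>\<^bsub>M\<^esub>"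
      using M one_closed
      by (auto simp: is_weighted_limit_def metric_semi_tropical_module_def module_morphism_def
          monoid_homs_def max_monoid_def bot_ennreal)
    then show ?case ..
  next
    case (insert e D)
    then obtain l where l: "is_weighted_limit X d D J W l" by auto
    have act: "act (W e) (J e) \<in> X"
      using M insert.prems by (auto simp: metric_semi_tropical_module_def semi_tropical_module_iff)
    have "is_weighted_limit X d (insert e D) J W (act (W e) (J e) \<otimes>\<^bsub>M\<^esub> l)"
      unfolding is_weighted_limit_def
    proof (intro conjI ballI)
      show "act (W e) (J e) \<otimes>\<^bsub>M\<^esub> l \<in> X"
        using act l m_closed by (simp add: car is_weighted_limit_def)
      fix x assume x: "x \<in> X"
      then have "d x (act (W e) (J e) \<otimes>\<^bsub>M\<^esub> l) = max (d x (act (W e) (J e))) (d x l)"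
        using M act l
        by (simp add: metric_semi_tropical_module_def module_morphism_def monoid_homs_def hom_def
            max_monoid_def is_weighted_limit_def)
      also have "d x (act (W e) (J e)) = d x (J e) \<midarrow> W e"
        using M x insert.prems
        by (simp add: metric_semi_tropical_module_def module_morphism_def max_act_def)
      also have "d x l = (SUP e\<in>D. d x (J e) \<midarrow> W e)"
        using l x by (simp add: is_weighted_limit_def)
      finally show "d x (act (W e) (J e) \<otimes>\<^bsub>M\<^esub> l) = (SUP e\<in>insert e D. d x (J e) \<midarrow> W e)"
        by (simp add: sup_max)
    qed
    then show ?case ..
  qed
qed

lemma finitely_complete_iff_metric_module:
  assumes "skeletal_gen_metric_space X d"
  shows "finitely_complete X d \<longleftrightarrow> (\<exists>M act. metric_semi_tropical_module X d M act)"
proof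
  assume "finitely_complete X d"
  with assms show "\<exists>M act. metric_semi_tropical_module X d M act"
    by (rule metric_module_of_finitely_complete)
next
  assume "\<exists>M act. metric_semi_tropical_module X d M act"
  then obtain M act where "metric_semi_tropical_module X d M act" by blast
  then show "finitely_complete X d"
    unfolding finitely_complete_def short_map_def
    by (intro allI impI) (rule metric_module_weighted_limit, simp_all)
qed

lemma op_dist_op_dist [simp]: "op_dist (op_dist d) = d"
  by (simp add: op_dist_def fun_eq_iff)

lemma gen_metric_space_op:
  assumes "gen_metric_space X d"
  shows "gen_metric_space X (op_dist d)"
proof -
  interpret gen_metric_space X d by fact
  show ?thesis
  proof
    fix x y z assume "x \<in> X" "y \<in> X" "z \<in> X"
    then have "d z x \<le> d z y + d y x"
      by (intro dist_triangle)
    then show "op_dist d x z \<le> op_dist d x y + op_dist d y z"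
      by (simp only: op_dist_def add.commute)
  qed (simp add: op_dist_def dist_self)
qed

lemma skeletal_gen_metric_space_op:
  "skeletal_gen_metric_space X d \<Longrightarrow> skeletal_gen_metric_space X (op_dist d)"
  by (auto simp: skeletal_gen_metric_space_def skeletal_gen_metric_space_axioms_def
      gen_metric_space_op) (auto simp: op_dist_def)

lemma short_map_op: "short_map D (op_dist dD) X (op_dist d) J \<longleftrightarrow> short_map D dD X d J"
  by (auto simp: short_map_def op_dist_def)

lemma finitely_complete_op: "finitely_complete X (op_dist d) \<longleftrightarrow> finitely_cocomplete X d"
proof -
  have colim: "is_weighted_colimit X d = is_weighted_limit X (op_dist d)"
    by (simp add: fun_eq_iff is_weighted_colimit_def is_weighted_limit_def op_dist_def)
  have shape: "gen_metric_space D (op_dist dD) \<longleftrightarrow> gen_metric_space D dD" for D :: "nat set" and dD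
    using gen_metric_space_op[of D dD] gen_metric_space_op[of D "op_dist dD"] by auto
  \<comment> \<open>The shape is reversed along with the space; the weight of a colimit already lives on the
    reversed shape.\<close>
  have reindex: "(\<forall>dD. P dD) \<longleftrightarrow> (\<forall>dD. P (op_dist dD))"
    for P :: "(nat \<Rightarrow> nat \<Rightarrow> ennreal) \<Rightarrow> bool"
    by (metis op_dist_op_dist)
  show ?thesis
    unfolding finitely_complete_def finitely_cocomplete_def colim
    by (subst reindex) (simp add: shape short_map_op)
qed

lemma metric_semi_tropical_module_op:
  "metric_semi_tropical_module X (op_dist d) M act \<longleftrightarrow> cometric_semi_tropical_module X d M act"
  by (simp add: metric_semi_tropical_module_def cometric_semi_tropical_module_def op_dist_def)

theorem mainTheorem2:
  fixes X :: "'a set" and d :: "'a \<Rightarrow> 'a \<Rightarrow> ennreal"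
  assumes "skeletal_gen_metric_space X d"
  shows "(finitely_complete X d \<longleftrightarrow> (\<exists>M act. metric_semi_tropical_module X d M act)) \<and>
         (finitely_cocomplete X d \<longleftrightarrow> (\<exists>M act. cometric_semi_tropical_module X d M act))"
  using finitely_complete_iff_metric_module[OF assms]
    finitely_complete_iff_metric_module[OF skeletal_gen_metric_space_op[OF assms]]
  by (simp add: finitely_complete_op metric_semi_tropical_module_op)

end
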